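(* Let $t\in\mathbb R$ with $0<|t|<1$, let $n\in\mathbb N$ and $w,z\in\mathbb C$. Then the function $$k_n(w,z)=\frac1n\,e^{n\left(-wz+\frac{tw^2}2+\frac{tz^2}2\right)}\sum_{m=0}^{n-1}p_{m,n}(w)\,p_{m,n}(z)$$ fulfills the identities $$\frac{\partial k_n}{\partial w}(w,z)+\frac{\partial k_n}{\partial z}(w,z)=-\sqrt{\frac{1-t}{1+t}}\left(p_{n,n}(w)p_{n-1,n}(z)+p_{n-1,n}(w)p_{n,n}(z)\right)e^{n\left(-wz+\frac{tw^2}2+\frac{tz^2}2\right)}$$ and $$\frac{\partial k_n}{\partial w}(w,z)-\frac{\partial k_n}{\partial z}(w,z)=\sqrt{\frac{1+t}{1-t}}\left(p_{n,n}(w)p_{n-1,n}(z)-p_{n-1,n}(w)p_{n,n}(z)\right)e^{n\left(-wz+\frac{tw^2}2+\frac{tz^2}2\right)}.$$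
   Context: For $n\in\mathbb N$ let $V(z)=|z|^2-\mathrm{Re}(tz^2)$ and let $(p_{k,n})_{k\ge0}$ be the polynomials with $\deg p_{k,n}=k$ and positive leading coefficient satisfying $\int_{\mathbb C}\overline{p_{k,n}(z)}p_{l,n}(z)e^{-nV(z)}\,d^2z=\delta_{kl}$ ($d^2z$ is Lebesgue measure). $k_n$ is holomorphic in both variables and the derivatives are complex derivatives. Note that in $k_n$ there is no complex conjugation of $p_{m,n}(w)$. *)

theory Defs
  imports "HOL-Complex_Analysis.Complex_Analysis" "HOL-Computational_Algebra.Polynomial"
begin

definition potential :: "real \<Rightarrow> complex \<Rightarrow> real" where
  "potential t z = (cmod z)\<^sup>2 - Re (complex_of_real t * z\<^sup>2)"

text \<open>
  \<open>p k\<close> stands for the polynomial \<open>p\<^bsub>k,n\<^esub>\<close>. A leading coefficient is positive in the sense that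
  it is a positive real number. Integrability of the integrands needs no separate clause: for
  \<open>\<bar>t\<bar> < 1\<close> and \<open>n \<ge> 1\<close> they have Gaussian decay.
\<close>

definition orthonormal_polys :: "real \<Rightarrow> nat \<Rightarrow> (nat \<Rightarrow> complex poly) \<Rightarrow> bool" where
  "orthonormal_polys t n p \<longleftrightarrow>
     (\<forall>k. degree (p k) = k \<and> lead_coeff (p k) \<in> \<real> \<and> Re (lead_coeff (p k)) > 0) \<and>
     (\<forall>k l. (LINT z|lborel. cnj (poly (p k) z) * poly (p l) z *
               complex_of_real (exp (- real n * potential t z))) = (if k = l then 1 else 0))"

definition exp_factor :: "real \<Rightarrow> nat \<Rightarrow> complex \<Rightarrow> complex \<Rightarrow> complex" where
  "exp_factor t n w z =
     exp (of_nat n * (- w * z + complex_of_real t * w\<^sup>2 / 2 + complex_of_real t * z\<^sup>2 / 2))"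

definition kernel :: "real \<Rightarrow> nat \<Rightarrow> (nat \<Rightarrow> complex poly) \<Rightarrow> complex \<Rightarrow> complex \<Rightarrow> complex" where
  "kernel t n p w z =
     1 / of_nat n * exp_factor t n w z * (\<Sum>m<n. poly (p m) w * poly (p m) z)"

end

theory Submission
  imports Defs
begin

text \<open>
  Integrating \<open>\<partial>\<^sub>z\<close> by parts against the Gaussian weight shows that the adjoint of multiplication by
  \<open>z\<close> on polynomials is \<open>t z + \<partial>\<^sub>z / n\<close>. Comparing matrix entries in the basis \<open>p\<close> makes multiplication
  by \<open>z\<close> tridiagonal and \<open>\<partial>\<^sub>z\<close> a lowering operator, and leading coefficients give the constants:
  with \<open>\<rho>\<^sub>m = sqrt (m / (n (1 - t\<^sup>2)))\<close>, both
  \<open>z p\<^sub>m = \<rho>\<^bsub>m+1\<^esub> p\<^bsub>m+1\<^esub> + t \<rho>\<^sub>m p\<^bsub>m-1\<^esub>\<close> and \<open>p\<^sub>m' = n (1 - t\<^sup>2) \<rho>\<^sub>m p\<^bsub>m-1\<^esub>\<close> hold. With these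
  recurrences both sums telescope.
\<close>

section \<open>Integrals of directional derivatives\<close>

text \<open>
  Averaging \<open>f (x + v) - f x = \<integral>\<^sub>0\<^sup>1 g (x + s v) ds\<close> over \<open>x\<close> gives \<open>0 = \<integral> g\<close> by translation invariance.
\<close>

lemma integral_directional_derivative_eq_0:
  fixes f g :: "'a::euclidean_space \<Rightarrow> 'b::euclidean_space"
  assumes deriv: "\<And>x s. ((\<lambda>s. f (x + s *\<^sub>R v)) has_vector_derivative g (x + s *\<^sub>R v)) (at s)"
    and cont: "continuous_on UNIV g"
    and f: "integrable lborel f" and g: "integrable lborel g"
  shows "(LINT x|lborel. g x) = 0"
proof -
  have tr: "integrable lborel (\<lambda>x. h (x + c)) \<and> (LINT x|lborel. h (x + c)) = (LINT x|lborel. h x)"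
    if h: "integrable lborel h" for h :: "'a \<Rightarrow> 'c::{banach,second_countable_topology}" and c
  proof -
    have "integrable (distr lborel borel ((+) c)) h"
      using h by (simp add: lborel_distr_plus)
    moreover have "(LINT x|distr lborel borel ((+) c). h x) = (LINT x|lborel. h x)"
      by (simp add: lborel_distr_plus)
    moreover have "h \<in> borel_measurable borel"
      using h by (auto dest: borel_measurable_integrable)
    ultimately show ?thesis
      by (simp add: integrable_distr_eq integral_distr add.commute)
  qed
  \<comment> \<open>The indicator turns the integral over \<open>s\<close> in [0,1] into one over
    all of \<open>lborel\<close>, so that Fubini applies to a product of two Lebesgue
    measures.\<close>
  define F where "F s x = indicator {0..1::real} s *\<^sub>R g (x + s *\<^sub>R v)" for s x
  have meas: "case_prod F \<in> borel_measurable (lborel \<Otimes>\<^sub>M lborel)"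
  proof -
    have [measurable]: "g \<in> borel_measurable borel"
      using cont by (rule borel_measurable_continuous_onI)
    show ?thesis
      unfolding F_def split_beta' by measurable
  qed
  have inner: "(LINT x|lborel. F s x) = indicator {0..1} s *\<^sub>R (LINT x|lborel. g x)" for s
    using tr[OF g, of "s *\<^sub>R v"] by (simp add: F_def)
  have int: "integrable (lborel \<Otimes>\<^sub>M lborel) (case_prod F)"
  proof (rule lborel_pair.Fubini_integrable[OF meas])
    \<comment> \<open>By translation invariance the inner integral is constant on [0,1] and zero
      outside, hence integrable in \<open>s\<close>.\<close>
    have "(LINT x|lborel. norm (F s x)) = indicator {0..1} s *\<^sub>R (LINT x|lborel. norm (g x))" for s
      using tr[OF integrable_norm[OF g], of "s *\<^sub>R v"] by (simp add: F_def indicator_def)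
    then show "integrable lborel (\<lambda>s. LINT x|lborel. norm (case_prod F (s, x)))"
      by simp
    show "AE s in lborel. integrable lborel (\<lambda>x. case_prod F (s, x))"
      using tr[OF g] by (simp add: F_def)
  qed
  have "(LINT s|lborel. F s x) = f (x + v) - f x" for x
  proof -
    have "continuous_on {0..1} (\<lambda>s. g (x + s *\<^sub>R v))"
      by (intro continuous_on_compose2[OF cont] continuous_intros) auto
    from integral_FTC_Icc[of 0 1 "\<lambda>s. f (x + s *\<^sub>R v)", OF _ _ this] deriv[of x]
    show ?thesis
      by (simp add: F_def has_vector_derivative_at_within)
  qed
  then have "(LINT x|lborel. (LINT s|lborel. F s x)) = 0"
    using tr[OF f, of v] f by simp
  moreover have "(LINT x|lborel. (LINT s|lborel. F s x)) = (LINT s|lborel. (LINT x|lborel. F s x))"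
    by (rule lborel_pair.Fubini_integral[OF int])
  ultimately show ?thesis
    by (simp add: inner)
qed

section \<open>The orthonormal basis and its pairing\<close>

locale elliptic_orthonormal_polys =
  fixes t :: real and n :: nat and p :: "nat \<Rightarrow> complex poly"
  assumes t_less: "\<bar>t\<bar> < 1" and n_pos: "n \<ge> 1" and orthonormal: "orthonormal_polys t n p"
begin

definition weight :: "complex \<Rightarrow> complex" where
  "weight z = complex_of_real (exp (- real n * potential t z))"

definition ip :: "complex poly \<Rightarrow> complex poly \<Rightarrow> complex" where
  "ip q r = (LINT z|lborel. cnj (poly q z) * poly r z * weight z)"

text \<open>Leading coefficients are real by normalisation, so \<open>Re\<close> loses nothing, and
  a real value lets positivity select square roots later.\<close>

definition lc :: "nat \<Rightarrow> real" where
  "lc k = Re (lead_coeff (p k))"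

lemma degree_p: "degree (p k) = k"
  using orthonormal by (simp add: orthonormal_polys_def)

lemma lc_pos: "lc k > 0"
  using orthonormal unfolding orthonormal_polys_def lc_def by blast

lemma coeff_p: "coeff (p k) k = of_real (lc k)"
  using orthonormal unfolding orthonormal_polys_def lc_def by (metis of_real_Re)

lemma coeff_p_eq_0: "k < i \<Longrightarrow> coeff (p k) i = 0"
  by (simp add: coeff_eq_0 degree_p)

lemma ip_p: "ip (p k) (p l) = (if k = l then 1 else 0)"
  using orthonormal unfolding orthonormal_polys_def ip_def weight_def by blast

text \<open>Each step removes the top coefficient with a multiple of \<open>p N\<close>. Bounding by
  vanishing coefficients instead of the degree lets \<open>N = 0\<close> describe the zero
  polynomial.\<close>

lemma span_p:
  assumes "\<And>i. i \<ge> N \<Longrightarrow> coeff q i = 0"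
  shows "\<exists>c. q = (\<Sum>k<N. smult (c k) (p k))"
  using assms
proof (induction N arbitrary: q)
  case 0
  then show ?case by (simp add: poly_eq_iff)
next
  case (Suc N)
  define d where "d = coeff q N / of_real (lc N)"
  have "coeff (q - smult d (p N)) i = 0" if "i \<ge> N" for i
    using that Suc.prems[of i] lc_pos[of N] coeff_p[of N] coeff_p_eq_0[of N i]
    by (cases "i = N") (auto simp: d_def)
  from Suc.IH[OF this] obtain c where c: "q - smult d (p N) = (\<Sum>k<N. smult (c k) (p k))"
    by blast
  have "q = (\<Sum>k<Suc N. smult ((c(N := d)) k) (p k))"
    using c by (simp add: algebra_simps)
  then show ?case by blast
qed

section \<open>Gaussian weight and integrability\<close>

text \<open>With the potential as a polynomial in \<open>z\<close> and \<open>cnj z\<close>, its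
  Wirtinger derivatives come from the ordinary product and chain rules.\<close>

lemma weight_eq_exp:
  "weight z = exp (- of_nat n * (z * cnj z - of_real t * (z\<^sup>2 + (cnj z)\<^sup>2) / 2))"
proof -
  have "of_real (potential t z) = z * cnj z - of_real t * (z\<^sup>2 + (cnj z)\<^sup>2) / 2"
    by (simp add: potential_def complex_eq_iff cmod_power2) (simp add: power2_eq_square field_simps)
  then show ?thesis
    unfolding weight_def by (simp flip: exp_of_real)
qed

lemma continuous_on_weight [continuous_intros]: "continuous_on A weight"
  unfolding weight_eq_exp by (intro continuous_intros) auto

lemma continuous_integrand:
  "continuous_on A (\<lambda>z. cnj (poly q z) * poly r z * weight z)"
  by (intro continuous_intros)

text \<open>The normalisation \<open>\<integral> = 1 \<noteq> 0\<close> already forces the diagonal integrands to be integrable.\<close>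

lemma integrable_p: "integrable lborel (\<lambda>z. cnj (poly (p k) z) * poly (p l) z * weight z)"
proof -
  have diag: "integrable lborel (\<lambda>z. cnj (poly (p k) z) * poly (p k) z * weight z)" for k
  proof (rule ccontr)
    assume "\<not> ?thesis"
    then have "ip (p k) (p k) = 0"
      unfolding ip_def by (rule not_integrable_integral_eq)
    then show False by (simp add: ip_p)
  qed
  show ?thesis
  \<comment> \<open>The mixed integrand is dominated by the sum of two diagonal ones, since 2ab
    \<le> a^2 + b^2.\<close>
  proof (rule Bochner_Integration.integrable_bound[OF Bochner_Integration.integrable_add
        [OF integrable_norm[OF diag[of k]] integrable_norm[OF diag[of l]]]])
    show "(\<lambda>z. cnj (poly (p k) z) * poly (p l) z * weight z) \<in> borel_measurable lborel"
      using borel_measurable_continuous_onI[OF continuous_integrand] by simp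
    show "AE z in lborel. norm (cnj (poly (p k) z) * poly (p l) z * weight z)
        \<le> norm (norm (cnj (poly (p k) z) * poly (p k) z * weight z) +
            norm (cnj (poly (p l) z) * poly (p l) z * weight z))"
    proof (rule AE_I2)
      fix z
      define a b where "a = cmod (poly (p k) z)" and "b = cmod (poly (p l) z)"
      have "2 * (a * b) \<le> a * a + b * b" "0 \<le> a * b"
        using sum_squares_bound[of a b] by (simp_all add: power2_eq_square a_def b_def)
      then have "a * b * cmod (weight z) \<le> (a * a + b * b) * cmod (weight z)"
        by (intro mult_right_mono) auto
      then show "norm (cnj (poly (p k) z) * poly (p l) z * weight z)
        \<le> norm (norm (cnj (poly (p k) z) * poly (p k) z * weight z) +
            norm (cnj (poly (p l) z) * poly (p l) z * weight z))"
        by (simp add: norm_mult a_def b_def algebra_simps)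
    qed
  qed
qed

lemma integrable_integrand: "integrable lborel (\<lambda>z. cnj (poly q z) * poly r z * weight z)"
proof -
  obtain c where c: "q = (\<Sum>k<Suc (degree q). smult (c k) (p k))"
    using span_p[of "Suc (degree q)" q] by (auto simp: coeff_eq_0)
  obtain d where d: "r = (\<Sum>k<Suc (degree r). smult (d k) (p k))"
    using span_p[of "Suc (degree r)" r] by (auto simp: coeff_eq_0)
  have "cnj (poly q z) * poly r z * weight z = (\<Sum>k<Suc (degree q). \<Sum>l<Suc (degree r).
      cnj (c k) * d l * (cnj (poly (p k) z) * poly (p l) z * weight z))" for z
  proof -
    have "cnj (poly q z) = (\<Sum>k<Suc (degree q). cnj (c k) * cnj (poly (p k) z))"
      by (subst c) (simp only: poly_sum poly_smult cnj_sum complex_cnj_mult)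
    moreover have "poly r z = (\<Sum>l<Suc (degree r). d l * poly (p l) z)"
      by (subst d) (simp only: poly_sum poly_smult)
    ultimately show ?thesis
      by (simp only: sum_product, simp only: sum_distrib_right, simp only: mult_ac)
  qed
  then show ?thesis
    by (simp only:) (intro Bochner_Integration.integrable_sum integrable_mult_right integrable_p)
qed

section \<open>Sesquilinearity and Fourier expansion\<close>

lemma ip_add_right: "ip q (r + r') = ip q r + ip q r'"
  by (simp add: ip_def distrib_left distrib_right integrable_integrand)

lemma ip_smult_right: "ip q (smult c r) = c * ip q r"
  by (simp add: ip_def algebra_simps flip: integral_mult_right_zero)

lemma ip_sum_right: "ip q (\<Sum>k\<in>A. f k) = (\<Sum>k\<in>A. ip q (f k))"
  by (induction A rule: infinite_finite_induct) (auto simp: ip_add_right ip_def[of q 0])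

lemma cnj_ip: "cnj (ip q r) = ip r q"
  by (simp add: ip_def weight_def mult_ac flip: Bochner_Integration.integral_cnj)

lemma expand_p:
  assumes "\<And>i. i \<ge> N \<Longrightarrow> coeff q i = 0"
  shows "q = (\<Sum>k<N. smult (ip (p k) q) (p k))"
proof -
  obtain c where c: "q = (\<Sum>k<N. smult (c k) (p k))"
    using span_p[OF assms] by blast
  have "ip (p k) q = c k" if "k < N" for k
    using that by (subst c) (simp add: ip_sum_right ip_smult_right ip_p if_distrib sum.delta cong: if_cong)
  then show ?thesis
    using c by simp
qed

lemma ip_eq_0:
  assumes "\<And>i. i \<ge> k \<Longrightarrow> coeff q i = 0"
  shows "ip (p k) q = 0"
  by (subst expand_p[OF assms]) (auto simp: ip_sum_right ip_smult_right ip_p intro!: sum.neutral)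

section \<open>Integration by parts\<close>

lemma has_vector_derivative_poly_line:
  fixes r :: "complex poly"
  shows "((\<lambda>s. poly r (x + s *\<^sub>R v)) has_vector_derivative v * poly (pderiv r) (x + s *\<^sub>R v)) (at s)"
proof -
  have "((\<lambda>s. x + s *\<^sub>R v) has_vector_derivative v) (at s)"
    by (auto intro!: derivative_eq_intros)
  from field_vector_diff_chain_at[where g = "poly r", OF this poly_DERIV] show ?thesis
    by (simp add: o_def)
qed

text \<open>The factors of \<open>v\<close> and \<open>cnj v\<close> in the bracket are the
  derivatives of the potential with respect to z and to its conjugate.\<close>

lemma has_vector_derivative_weight_line:
  fixes x v :: complex
  defines "y \<equiv> \<lambda>s. x + s *\<^sub>R v"
  shows "((\<lambda>s. weight (y s)) has_vector_derivative
    - of_nat n * (v * (cnj (y s) - of_real t * y s) + cnj v * (y s - of_real t * cnj (y s))) * weight (y s)) (at s)"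
proof -
  have y: "(y has_vector_derivative v) (at s)"
    unfolding y_def by (auto intro!: derivative_eq_intros)
  have cy: "((\<lambda>s. cnj (y s)) has_vector_derivative cnj v) (at s)"
    using y by (rule has_vector_derivative_cnj)
  have "((\<lambda>s. - of_nat n * (y s * cnj (y s) - of_real t * (y s * y s + cnj (y s) * cnj (y s)) / 2))
      has_vector_derivative
      - of_nat n * (v * (cnj (y s) - of_real t * y s) + cnj v * (y s - of_real t * cnj (y s)))) (at s)"
    by (rule derivative_eq_intros y cy refl | simp add: field_simps)+
  from field_vector_diff_chain_at[OF this DERIV_exp] show ?thesis
    by (simp add: o_def weight_eq_exp power2_eq_square)
qed

text \<open>Integration by parts for the Wirtinger derivative \<open>\<partial>\<^sub>z\<close>, obtained from the directional
  derivatives along \<open>1\<close> and \<open>\<i>\<close>.\<close>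

lemma ip_pCons_left:
  "ip (pCons 0 q) r = of_real t * ip q (pCons 0 r) + ip q (pderiv r) / of_nat n"
proof -
  \<comment> \<open>\<open>G\<close> and \<open>H\<close> are the derivatives of the integrand with
    respect to z and to its conjugate; along \<open>v\<close> the derivative is
    \<open>v * G + cnj v * H\<close>.\<close>
  define G where "G z = cnj (poly q z) * poly (pderiv r) z * weight z
      - of_nat n * (cnj (poly (pCons 0 q) z) * poly r z * weight z)
      + of_nat n * of_real t * (cnj (poly q z) * poly (pCons 0 r) z * weight z)" for z
  define H where "H z = cnj (poly (pderiv q) z) * poly r z * weight z
      - of_nat n * (cnj (poly q z) * poly (pCons 0 r) z * weight z)
      + of_nat n * of_real t * (cnj (poly (pCons 0 q) z) * poly r z * weight z)" for z
  have G: "integrable lborel G" and H: "integrable lborel H"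
    unfolding G_def H_def
    by (intro Bochner_Integration.integrable_add Bochner_Integration.integrable_diff
        integrable_mult_right integrable_integrand)+
  have "v * integral\<^sup>L lborel G + cnj v * integral\<^sup>L lborel H = 0" for v
  proof -
    have "(LINT z|lborel. v * G z + cnj v * H z) = 0"
    proof (rule integral_directional_derivative_eq_0)
      show "continuous_on UNIV (\<lambda>z. v * G z + cnj v * H z)"
        unfolding G_def H_def by (intro continuous_intros)
      show "integrable lborel (\<lambda>z. cnj (poly q z) * poly r z * weight z)"
        by (rule integrable_integrand)
      show "integrable lborel (\<lambda>z. v * G z + cnj v * H z)"
        using G H by simp
      show "((\<lambda>s. cnj (poly q (x + s *\<^sub>R v)) * poly r (x + s *\<^sub>R v) * weight (x + s *\<^sub>R v))
          has_vector_derivative v * G (x + s *\<^sub>R v) + cnj v * H (x + s *\<^sub>R v)) (at s)" for x s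
        by (rule has_vector_derivative_eq_rhs,
            (rule has_vector_derivative_mult has_vector_derivative_cnj
              has_vector_derivative_poly_line has_vector_derivative_weight_line)+)
          (simp add: G_def H_def algebra_simps)
    qed
    then show ?thesis using G H by simp
  qed
  \<comment> \<open>\<open>v = 1\<close> makes the two integrals sum to zero,
    \<open>v = \<i>\<close> makes them equal.\<close>
  from this[of 1] this[of \<i>] have "integral\<^sup>L lborel G = 0"
    by (simp add: algebra_simps)
  moreover have "integral\<^sup>L lborel G =
      ip q (pderiv r) - of_nat n * ip (pCons 0 q) r + of_nat n * of_real t * ip q (pCons 0 r)"
    unfolding G_def ip_def
    using integrable_integrand[of q "pderiv r"] integrable_integrand[of "pCons 0 q" r]
      integrable_integrand[of q "pCons 0 r"]
    by (simp del: poly_pCons)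
  ultimately show ?thesis
    using n_pos by (simp add: field_simps)
qed

section \<open>Matrix of multiplication and the recurrences\<close>

definition rho :: "nat \<Rightarrow> real" where
  "rho m = sqrt (real m / (real n * (1 - t\<^sup>2)))"

definition mult_matrix :: "nat \<Rightarrow> nat \<Rightarrow> complex" where
  "mult_matrix j k = ip (p j) (pCons 0 (p k))"

lemma one_minus_t2_pos: "1 - t\<^sup>2 > 0"
  using t_less by (simp add: abs_square_less_1)

lemma mult_matrix_eq_0_above:
  assumes "Suc k < j"
  shows "mult_matrix j k = 0"
  unfolding mult_matrix_def
  using assms by (intro ip_eq_0) (auto simp: coeff_pCons coeff_p_eq_0 split: nat.split)

lemma ip_pderiv_eq_0:
  assumes "m \<le> k"
  shows "ip (p k) (pderiv (p m)) = 0"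
  using assms by (intro ip_eq_0) (auto simp: coeff_pderiv coeff_p_eq_0)

text \<open>This is the adjoint relation between basis vectors. Combined with degree bounds it
  determines all entries up to the ratios of leading coefficients.\<close>

lemma cnj_mult_matrix: "cnj (mult_matrix m k) = of_real t * mult_matrix k m + ip (p k) (pderiv (p m)) / of_nat n"
  unfolding mult_matrix_def cnj_ip by (rule ip_pCons_left)

text \<open>On the diagonal the derivative term vanishes, so the entry has modulus \<bar>t\<bar>
  times itself, with \<bar>t\<bar> < 1.\<close>

lemma mult_matrix_diag: "mult_matrix m m = 0"
proof -
  have "cnj (mult_matrix m m) = of_real t * mult_matrix m m"
    using cnj_mult_matrix[of m m] by (simp add: ip_pderiv_eq_0)
  then have "cmod (mult_matrix m m) = \<bar>t\<bar> * cmod (mult_matrix m m)"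
    by (metis complex_mod_cnj norm_mult norm_of_real)
  then show ?thesis using t_less by simp
qed

lemma mult_matrix_eq_0_below:
  assumes "Suc k < m"
  shows "mult_matrix k m = 0"
  using cnj_mult_matrix[of k m] assms by (simp add: mult_matrix_eq_0_above ip_pderiv_eq_0)

lemma pCons_p: "pCons 0 (p m) = (\<Sum>k<Suc (Suc m). smult (mult_matrix k m) (p k))"
  unfolding mult_matrix_def by (rule expand_p) (auto simp: coeff_pCons coeff_p_eq_0 split: nat.split)

lemma mult_matrix_lower: "mult_matrix (Suc m) m = of_real (lc m / lc (Suc m))"
  using arg_cong[OF pCons_p[of m], of "\<lambda>q. coeff q (Suc m)"] lc_pos[of "Suc m"]
  by (simp add: coeff_sum coeff_p coeff_p_eq_0 field_simps)

lemma mult_matrix_upper: "mult_matrix m (Suc m) = of_real t * mult_matrix (Suc m) m"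
proof -
  have "mult_matrix m (Suc m) = cnj (of_real t * mult_matrix (Suc m) m)"
    using arg_cong[OF cnj_mult_matrix[of m "Suc m"], of cnj] by (simp add: ip_pderiv_eq_0)
  then show ?thesis by (simp add: mult_matrix_lower)
qed

text \<open>In the adjoint relation both matrix entries vanish for \<open>k < m\<close>, leaving
  only the component along \<open>p m\<close>. There the neighbouring entries differ by the factor
  \<open>t\<close>, which enters twice and gives 1 - t^2.\<close>

lemma pderiv_p_Suc:
  "pderiv (p (Suc m)) = smult (of_nat n * of_real (1 - t\<^sup>2) * mult_matrix (Suc m) m) (p m)"
proof -
  have "coeff (pderiv (p (Suc m))) i = 0" if "i \<ge> Suc m" for i
    using that by (simp add: coeff_pderiv coeff_p_eq_0)
  note expand_p[OF this]
  also have "(\<Sum>k<Suc m. smult (ip (p k) (pderiv (p (Suc m)))) (p k)) =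
      smult (ip (p m) (pderiv (p (Suc m)))) (p m)"
  proof -
    have "ip (p k) (pderiv (p (Suc m))) = 0" if "k < m" for k
      using cnj_mult_matrix[of "Suc m" k] that n_pos by (simp add: mult_matrix_eq_0_above mult_matrix_eq_0_below)
    then show ?thesis by simp
  qed
  also have "ip (p m) (pderiv (p (Suc m))) =
      of_nat n * of_real (1 - t\<^sup>2) * mult_matrix (Suc m) m"
  proof -
    have "cnj (mult_matrix (Suc m) m) = mult_matrix (Suc m) m"
      by (simp add: mult_matrix_lower)
    with cnj_mult_matrix[of "Suc m" m] n_pos show ?thesis
      by (simp add: mult_matrix_upper field_simps power2_eq_square)
  qed
  finally show ?thesis .
qed

text \<open>Leading coefficients in the lowering relation give a second equation for the ratio
  \<open>g\<close> of consecutive leading coefficients; eliminating them fixes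
  \<open>g\<^sup>2\<close>, and positivity picks the root.\<close>

lemma mult_matrix_lower_eq_rho: "mult_matrix (Suc m) m = of_real (rho (Suc m))"
proof -
  define g where "g = lc m / lc (Suc m)"
  have "g > 0" unfolding g_def using lc_pos by simp
  have g: "mult_matrix (Suc m) m = of_real g"
    by (simp add: g_def mult_matrix_lower)
  have "of_real (real (Suc m) * lc (Suc m)) = (of_real (real n * (1 - t\<^sup>2) * g * lc m) :: complex)"
    using arg_cong[OF pderiv_p_Suc[of m], of "\<lambda>q. coeff q m"]
    by (simp add: coeff_pderiv coeff_p g)
  then have "real (Suc m) * lc (Suc m) = real n * (1 - t\<^sup>2) * g * lc m"
    by (simp only: of_real_eq_iff)
  also have "lc m = g * lc (Suc m)"
    using lc_pos[of "Suc m"] by (simp add: g_def)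
  finally have "real (Suc m) = real n * (1 - t\<^sup>2) * g\<^sup>2"
    using lc_pos[of "Suc m"] by (simp add: power2_eq_square)
  then have "g\<^sup>2 = real (Suc m) / (real n * (1 - t\<^sup>2))"
    using n_pos one_minus_t2_pos by (simp add: field_simps)
  then have "g = rho (Suc m)"
    using \<open>g > 0\<close> unfolding rho_def by (metis real_sqrt_abs abs_of_pos)
  then show ?thesis by (simp add: g)
qed

text \<open>In the next two lemmas \<open>m = 0\<close> is covered because \<open>rho 0 = 0\<close>.\<close>

lemma poly_pderiv_p: "poly (pderiv (p m)) z = of_nat n * of_real ((1 - t\<^sup>2) * rho m) * poly (p (m - 1)) z"
proof (cases m)
  case 0
  have "pderiv (p 0) = 0"
    using degree_p[of 0] by (simp add: pderiv_eq_0_iff)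
  then show ?thesis using 0 by (simp add: rho_def)
next
  case (Suc m')
  then show ?thesis by (simp add: pderiv_p_Suc mult_matrix_lower_eq_rho)
qed

lemma three_term_recurrence:
  "z * poly (p m) z =
     of_real (rho (Suc m)) * poly (p (Suc m)) z + of_real (t * rho m) * poly (p (m - 1)) z"
proof -
  have "z * poly (p m) z = (\<Sum>k<Suc (Suc m). mult_matrix k m * poly (p k) z)"
    using arg_cong[OF pCons_p[of m], of "\<lambda>q. poly q z"] by (simp add: poly_sum)
  also have "\<dots> = of_real (rho (Suc m)) * poly (p (Suc m)) z + (\<Sum>k<m. mult_matrix k m * poly (p k) z)"
    by (simp add: mult_matrix_diag mult_matrix_lower_eq_rho)
  also have "(\<Sum>k<m. mult_matrix k m * poly (p k) z) = of_real (t * rho m) * poly (p (m - 1)) z"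
  proof (cases m)
    case 0
    then show ?thesis by (simp add: rho_def)
  next
    case (Suc m')
    then have "(\<Sum>k<m. mult_matrix k m * poly (p k) z) =
        (\<Sum>k<m'. mult_matrix k m * poly (p k) z) + mult_matrix m' m * poly (p m') z"
      by simp
    also have "(\<Sum>k<m'. mult_matrix k m * poly (p k) z) = 0"
      using Suc by (simp add: mult_matrix_eq_0_below)
    finally show ?thesis
      using Suc by (simp add: mult_matrix_upper mult_matrix_lower_eq_rho)
  qed
  finally show ?thesis .
qed

section \<open>Telescoping of the kernel sums\<close>

text \<open>The two identities of the theorem correspond to \<open>\<sigma> = 1\<close> and \<open>\<sigma> = -1\<close>.\<close>

lemma kernel_sum_telescope:
  fixes \<sigma> :: complex
  assumes "\<sigma> = 1 \<or> \<sigma> = -1"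
  shows
    "(of_real t - \<sigma>) * (w + \<sigma> * z) * (\<Sum>m<N. poly (p m) w * poly (p m) z) +
       ((\<Sum>m<N. poly (pderiv (p m)) w * poly (p m) z) +
         \<sigma> * (\<Sum>m<N. poly (p m) w * poly (pderiv (p m)) z)) / of_nat n =
     (of_real t - \<sigma>) * of_real (rho N) *
       (poly (p N) w * poly (p (N - 1)) z + \<sigma> * (poly (p (N - 1)) w * poly (p N) z))"
proof (induction N)
  \<comment> \<open>Here \<open>N - 1\<close> is truncated to 0, but the factor
    \<open>rho 0 = 0\<close> removes the right-hand side.\<close>
  case 0
  then show ?case by (simp add: rho_def)
next
  case (Suc N)
  define a b c d e f where "a = poly (p N) w" and "b = poly (p N) z"
    and "c = poly (p (Suc N)) w" and "d = poly (p (Suc N)) z"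
    and "e = poly (p (N - 1)) w" and "f = poly (p (N - 1)) z"
  note abbrs = this
  define a' b' where "a' = poly (pderiv (p N)) w" and "b' = poly (pderiv (p N)) z"
  note abbrs' = this
  define S A B where "S = (\<Sum>m<N. poly (p m) w * poly (p m) z)"
    and "A = (\<Sum>m<N. poly (pderiv (p m)) w * poly (p m) z)"
    and "B = (\<Sum>m<N. poly (p m) w * poly (pderiv (p m)) z)"
  note sums = this
  have rec: "w * a = of_real (rho (Suc N)) * c + of_real (t * rho N) * e"
    "z * b = of_real (rho (Suc N)) * d + of_real (t * rho N) * f"
    unfolding abbrs by (rule three_term_recurrence)+
  have der: "(a' * b + \<sigma> * (a * b')) / of_nat n =
      of_real ((1 - t\<^sup>2) * rho N) * (e * b + \<sigma> * (a * f))"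
    using n_pos by (simp add: poly_pderiv_p abbrs abbrs' field_simps)
  have "(of_real t - \<sigma>) * (w + \<sigma> * z) * (S + a * b) + ((A + a' * b) + \<sigma> * (B + a * b')) / of_nat n =
      ((of_real t - \<sigma>) * (w + \<sigma> * z) * S + (A + \<sigma> * B) / of_nat n) +
      (of_real t - \<sigma>) * (w * a * b + \<sigma> * (a * (z * b))) + (a' * b + \<sigma> * (a * b')) / of_nat n"
    by (simp add: algebra_simps add_divide_distrib)
  also have "(of_real t - \<sigma>) * (w + \<sigma> * z) * S + (A + \<sigma> * B) / of_nat n =
      (of_real t - \<sigma>) * of_real (rho N) * (a * f + \<sigma> * (e * b))"
    using Suc.IH unfolding abbrs sums .
  \<comment> \<open>Since \<sigma>^2 = 1, \<open>a * f + \<sigma> * (e * b)\<close> is \<sigma>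
    times \<open>e * b + \<sigma> * (a * f)\<close>. The terms with \<open>rho N\<close> then cancel
    because (t - \<sigma>)(t + \<sigma>) + (1 - t^2) = 0.\<close>
  also have "\<dots> + (of_real t - \<sigma>) * (w * a * b + \<sigma> * (a * (z * b))) +
      (a' * b + \<sigma> * (a * b')) / of_nat n =
      (of_real t - \<sigma>) * of_real (rho (Suc N)) * (c * b + \<sigma> * (a * d))"
    unfolding rec der using assms by (elim disjE) (simp_all add: algebra_simps power2_eq_square)
  finally show ?case
    by (simp add: abbrs abbrs' sums)
qed

lemma rho_n: "rho n = 1 / sqrt (1 - t\<^sup>2)"
  using n_pos by (simp add: rho_def real_sqrt_divide real_sqrt_mult)

text \<open>This evaluates the boundary constant for \<sigma> = 1: factor 1 - t^2 as (1 - t)(1 + t)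
  and cancel one root.\<close>

lemma t_minus_1_rho_n: "(t - 1) * rho n = - sqrt ((1 - t) / (1 + t))"
proof -
  have "sqrt (1 - t\<^sup>2) = sqrt (1 - t) * sqrt (1 + t)"
    by (simp add: algebra_simps power2_eq_square flip: real_sqrt_mult)
  moreover have "sqrt (1 - t) * sqrt (1 - t) = 1 - t" "sqrt (1 - t) \<noteq> 0" "sqrt (1 + t) \<noteq> 0"
    using t_less by auto
  ultimately show ?thesis
    unfolding rho_n real_sqrt_divide by (simp add: divide_simps mult_ac)
qed

lemma t_plus_1_rho_n: "(t + 1) * rho n = sqrt ((1 + t) / (1 - t))"
proof -
  have "sqrt (1 - t\<^sup>2) = sqrt (1 - t) * sqrt (1 + t)"
    by (simp add: algebra_simps power2_eq_square flip: real_sqrt_mult)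
  moreover have "sqrt (1 + t) * sqrt (1 + t) = 1 + t" "sqrt (1 - t) \<noteq> 0" "sqrt (1 + t) \<noteq> 0"
    using t_less by auto
  ultimately show ?thesis
    unfolding rho_n real_sqrt_divide by (simp add: divide_simps mult_ac)
qed

end

section \<open>Derivatives of the kernel and the two identities\<close>

lemma kernel_commute: "kernel t n p w z = kernel t n p z w"
  by (simp add: kernel_def exp_factor_def algebra_simps)

lemma exp_factor_commute: "exp_factor t n w z = exp_factor t n z w"
  by (simp add: exp_factor_def algebra_simps)

text \<open>The prefactor 1/n cancels the n from differentiating the exponent and survives only on
  the differentiated polynomials.\<close>

lemma deriv_kernel:
  assumes "n \<ge> 1"
  shows "deriv (\<lambda>u. kernel t n p u z) w =
    exp_factor t n w z * ((of_real t * w - z) * (\<Sum>m<n. poly (p m) w * poly (p m) z) +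
      (\<Sum>m<n. poly (pderiv (p m)) w * poly (p m) z) / of_nat n)"
proof (rule DERIV_imp_deriv)
  have E: "((\<lambda>u. exp_factor t n u z) has_field_derivative
      exp_factor t n w z * (of_nat n * (of_real t * w - z))) (at w)"
    unfolding exp_factor_def by (rule derivative_eq_intros refl | simp add: algebra_simps)+
  have S: "((\<lambda>u. \<Sum>m<n. poly (p m) u * poly (p m) z) has_field_derivative
      (\<Sum>m<n. poly (pderiv (p m)) w * poly (p m) z)) (at w)"
    by (intro DERIV_sum DERIV_cmult_right poly_DERIV)
  show "((\<lambda>u. kernel t n p u z) has_field_derivative
      exp_factor t n w z * ((of_real t * w - z) * (\<Sum>m<n. poly (p m) w * poly (p m) z) +
      (\<Sum>m<n. poly (pderiv (p m)) w * poly (p m) z) / of_nat n)) (at w)"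
    unfolding kernel_def
    by (rule DERIV_cong, rule DERIV_mult[OF DERIV_cmult[OF E] S])
       (use assms in \<open>simp add: field_simps\<close>)
qed

theorem proposition5p4:
  fixes t :: real and n :: nat and p :: "nat \<Rightarrow> complex poly" and w z :: complex
  assumes "0 < \<bar>t\<bar>" and "\<bar>t\<bar> < 1"
    and "n \<ge> 1"
    and "orthonormal_polys t n p"
  shows "deriv (\<lambda>u. kernel t n p u z) w + deriv (\<lambda>v. kernel t n p w v) z =
           - complex_of_real (sqrt ((1 - t) / (1 + t))) *
             (poly (p n) w * poly (p (n - 1)) z + poly (p (n - 1)) w * poly (p n) z) *
             exp_factor t n w z \<and>
         deriv (\<lambda>u. kernel t n p u z) w - deriv (\<lambda>v. kernel t n p w v) z =
           complex_of_real (sqrt ((1 + t) / (1 - t))) *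
             (poly (p n) w * poly (p (n - 1)) z - poly (p (n - 1)) w * poly (p n) z) *
             exp_factor t n w z"
proof -
  interpret elliptic_orthonormal_polys t n p
    using assms by unfold_locales
  define S A B E where "S = (\<Sum>m<n. poly (p m) w * poly (p m) z)"
    and "A = (\<Sum>m<n. poly (pderiv (p m)) w * poly (p m) z) / of_nat n"
    and "B = (\<Sum>m<n. poly (p m) w * poly (pderiv (p m)) z) / of_nat n"
    and "E = exp_factor t n w z"
  have dw: "deriv (\<lambda>u. kernel t n p u z) w = E * ((of_real t * w - z) * S + A)"
    using deriv_kernel[OF assms(3)] by (simp add: S_def A_def E_def)
  have dz: "deriv (\<lambda>v. kernel t n p w v) z = E * ((of_real t * z - w) * S + B)"
    using deriv_kernel[OF assms(3), of t p w z]
    \<comment> \<open>Symmetry of the kernel reduces the second derivative to the first with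
      \<open>w\<close> and \<open>z\<close> exchanged.\<close>
    by (subst kernel_commute) (simp add: S_def B_def E_def exp_factor_commute mult.commute)
  have "(of_real t - 1) * (w + z) * S + (A + B) = - of_real (sqrt ((1 - t) / (1 + t))) *
      (poly (p n) w * poly (p (n - 1)) z + poly (p (n - 1)) w * poly (p n) z)"
  proof -
    have "(of_real t - 1) * of_real (rho n) = - complex_of_real (sqrt ((1 - t) / (1 + t)))"
      using arg_cong[OF t_minus_1_rho_n, of complex_of_real] by simp
    with kernel_sum_telescope[of 1 w z n] show ?thesis
      by (simp add: S_def A_def B_def add_divide_distrib)
  qed
  moreover have "(of_real t + 1) * (w - z) * S + (A - B) = of_real (sqrt ((1 + t) / (1 - t))) *
      (poly (p n) w * poly (p (n - 1)) z - poly (p (n - 1)) w * poly (p n) z)"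
  proof -
    have "(of_real t + 1) * of_real (rho n) = complex_of_real (sqrt ((1 + t) / (1 - t)))"
      using arg_cong[OF t_plus_1_rho_n, of complex_of_real] by simp
    with kernel_sum_telescope[of "-1" w z n] show ?thesis
      by (simp add: S_def A_def B_def diff_divide_distrib)
  qed
  \<comment> \<open>Adding and subtracting the exponent derivatives produces the factors (t -
    \<sigma>)(w + \<sigma> z) of the telescoped sums for \<sigma> = 1 and \<sigma> = -1.\<close>
  moreover have "E * ((of_real t * w - z) * S + A) + E * ((of_real t * z - w) * S + B) =
      ((of_real t - 1) * (w + z) * S + (A + B)) * E"
    "E * ((of_real t * w - z) * S + A) - E * ((of_real t * z - w) * S + B) =
      ((of_real t + 1) * (w - z) * S + (A - B)) * E"
    by (simp_all add: algebra_simps)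
  ultimately show ?thesis
    unfolding dw dz E_def[symmetric] by simp
qed

end
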